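(* Let $p$ be a prime not dividing $6$, let $q$ be a power of $p$, and let $k$ be an algebraic closure of $\mathbb{F}_q(t)$. Let $E$ be the (ordinary) Legendre elliptic curve $y^2=x(x+1)(x+t)$ over $k$, and let $E^{can}$ be its canonical lifting over $W(k)$, with canonical Legendre coordinate $\tilde\lambda\in W(k)$. Let $n=p^f+1$ for an integer $f\geq 1$. Then Ulmer's rational point $\left(u,u(u+1)^{(p^f+1)/2}\right)$ on $E$, where $u\in k$ and $u^n=t$, lifts to a point $$\tilde P=\left(\tilde u,\;\tilde u(\tilde u+1)\sqrt{\frac{\tilde u^{n-1}+1}{\tilde u+1}}\right)\in E^{can}(B),$$ where $$B=W(k)\left[\tilde u,\sqrt{\frac{\tilde u^{n-1}+1}{\tilde u+1}}\right]\quad\text{with } \tilde u^n=\tilde\lambda.$$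
   Context: $t$ is an indeterminate over $\mathbb{F}_q$, and $W(k)$ is the ring of $p$-typical Witt vectors of $k$. The canonical lifting $E^{can}$ is the Serre–Tate canonical lift of the ordinary curve $E$ to $W(k)$. A canonical Legendre coordinate for an ordinary Legendre curve $y^2=x(x+1)(x+\lambda)$ over $k$ is an element $\tilde\lambda\in W(k)$ with $\tilde\lambda\equiv\lambda\bmod p$ such that $E^{can}$ is given by $y^2=x(x+1)(x+\tilde\lambda)$ (such an element exists); here $\lambda=t$. Since $n$ is even, $\frac{\tilde u^{n-1}+1}{\tilde u+1}=\sum_{i=0}^{n-2}(-1)^i\tilde u^i$, and the square root is a chosen element squaring to it. "Lifts" means that, for suitable choices of $\tilde u$ and of the square root, the reduction of $\tilde P$ modulo $p$ is the given point of $E(k)$. *)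

theory Defs
  imports
    "HOL-Computational_Algebra.Computational_Algebra"
    "HOL-Library.Poly_Mapping"
    "HOL-Algebra.Algebraic_Closure_Type"
begin

text \<open>Integer polynomials in countably many variables; the keys are the exponent vectors.\<close>

type_synonym mpoly_int = "(nat \<Rightarrow>\<^sub>0 nat) \<Rightarrow>\<^sub>0 int"

definition mvar :: "nat \<Rightarrow> mpoly_int" where
  "mvar i = Poly_Mapping.single (Poly_Mapping.single i 1) 1"

definition mmon :: "(nat \<Rightarrow> 'a::comm_ring_1) \<Rightarrow> (nat \<Rightarrow>\<^sub>0 nat) \<Rightarrow> 'a" where
  "mmon \<phi> m = (\<Prod>i\<in>Poly_Mapping.keys m. \<phi> i ^ Poly_Mapping.lookup m i)"

definition meval :: "(nat \<Rightarrow> 'a::comm_ring_1) \<Rightarrow> mpoly_int \<Rightarrow> 'a" where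
  "meval \<phi> P = (\<Sum>m\<in>Poly_Mapping.keys P. of_int (Poly_Mapping.lookup P m) * mmon \<phi> m)"

definition ghost :: "nat \<Rightarrow> nat \<Rightarrow> (nat \<Rightarrow> 'a::comm_ring_1) \<Rightarrow> 'a" where
  "ghost p n x = (\<Sum>i\<le>n. of_nat p ^ i * x i ^ (p ^ (n - i)))"

lemma mmon_altdef:
  assumes "finite A" "Poly_Mapping.keys m \<subseteq> A"
  shows "mmon \<phi> m = (\<Prod>i\<in>A. \<phi> i ^ Poly_Mapping.lookup m i)"
  unfolding mmon_def by (rule prod.mono_neutral_left) (use assms in \<open>auto simp: in_keys_iff\<close>)

lemma mmon_0 [simp]: "mmon \<phi> 0 = 1"
  by (simp add: mmon_def)

lemma mmon_add: "mmon \<phi> (m + n) = mmon \<phi> m * mmon \<phi> n"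
proof -
  let ?A = "Poly_Mapping.keys m \<union> Poly_Mapping.keys n"
  have "mmon \<phi> (m + n) = (\<Prod>i\<in>?A. \<phi> i ^ Poly_Mapping.lookup (m + n) i)"
    by (intro mmon_altdef) (auto simp: keys_add)
  also have "\<dots> = (\<Prod>i\<in>?A. \<phi> i ^ Poly_Mapping.lookup m i) * (\<Prod>i\<in>?A. \<phi> i ^ Poly_Mapping.lookup n i)"
    by (simp add: lookup_add power_add prod.distrib)
  also have "\<dots> = mmon \<phi> m * mmon \<phi> n"
    by (simp add: mmon_altdef[of ?A])
  finally show ?thesis .
qed

lemma meval_0 [simp]: "meval \<phi> 0 = 0"
  by (simp add: meval_def)

lemma meval_add: "meval \<phi> (P + Q) = meval \<phi> P + meval \<phi> Q"
  unfolding meval_def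
  by (rule setsum_keys_plus_distrib[where f = "\<lambda>m c. of_int c * mmon \<phi> m"]) (auto simp: algebra_simps)

lemma meval_uminus: "meval \<phi> (- P) = - meval \<phi> P"
  by (simp add: meval_def sum_negf)

lemma meval_diff: "meval \<phi> (P - Q) = meval \<phi> P - meval \<phi> Q"
  using meval_add[of \<phi> P "- Q"] by (simp add: meval_uminus)

lemma meval_single: "meval \<phi> (Poly_Mapping.single m c) = of_int c * mmon \<phi> m"
  by (simp add: meval_def)

lemma meval_1 [simp]: "meval \<phi> 1 = 1"
  by (metis meval_single single_one mmon_0 of_int_1 mult_1)

lemma meval_mvar [simp]: "meval \<phi> (mvar i) = \<phi> i"
  by (simp add: mvar_def meval_single mmon_def)

lemma meval_mult: "meval \<phi> (P * Q) = meval \<phi> P * meval \<phi> Q"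
proof -
  have *: "meval \<phi> (frag_of m * Q) = meval \<phi> (frag_of m) * meval \<phi> Q" for m
    by (rule frag_induction[of Q UNIV])
       (auto simp: mult_single meval_single mmon_add meval_diff right_diff_distrib)
  show ?thesis
    by (rule frag_induction[of P UNIV]) (auto simp: * meval_diff left_diff_distrib)
qed

lemma meval_power: "meval \<phi> (P ^ n) = meval \<phi> P ^ n"
  by (induction n) (auto simp: meval_mult)

lemma meval_sum: "meval \<phi> (sum f A) = (\<Sum>x\<in>A. meval \<phi> (f x))"
  by (induction A rule: infinite_finite_induct) (auto simp: meval_add)

lemma meval_of_nat [simp]: "meval \<phi> (of_nat n) = of_nat n"
  by (induction n) (auto simp: meval_add)

lemmas meval_hom = meval_add meval_uminus meval_diff meval_mult meval_power meval_sum

lemma mvar_power: "mvar i ^ n = Poly_Mapping.single (Poly_Mapping.single i n) 1"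
proof (induction n)
  case (Suc n)
  then show ?case by (simp add: mvar_def mult_single single_add[symmetric])
qed auto

lemma frag_of_conv_mmon: "frag_of m = mmon mvar m"
proof -
  have "(\<Prod>i\<in>A. mvar i ^ Poly_Mapping.lookup m i) =
          frag_of (\<Sum>i\<in>A. Poly_Mapping.single i (Poly_Mapping.lookup m i))" if "finite A" for A
    using that by (induction A rule: finite_induct) (auto simp: mvar_power mult_single)
  moreover have "(\<Sum>i\<in>Poly_Mapping.keys m. Poly_Mapping.single i (Poly_Mapping.lookup m i)) = m"
    by (rule poly_mapping_eqI)
       (auto simp: lookup_sum lookup_single when_def in_keys_iff)
  ultimately show ?thesis by (simp add: mmon_def)
qed

lemma mpoly_int_induct [case_names one var diff mult]:
  assumes "Q 1" "\<And>i. Q (mvar i)" "\<And>a b. Q a \<Longrightarrow> Q b \<Longrightarrow> Q (a - b)" "\<And>a b. Q a \<Longrightarrow> Q b \<Longrightarrow> Q (a * b)"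
  shows "Q P"
proof (rule frag_induction[of P UNIV])
  show "Q 0" using assms(3)[OF assms(1) assms(1)] by simp
  have pow: "Q (mvar i ^ n)" for i n
    by (induction n) (auto intro: assms)
  have "Q (\<Prod>i\<in>A. mvar i ^ Poly_Mapping.lookup m i)" if "finite A" for m A
    using that by (induction A rule: finite_induct) (auto intro: assms pow)
  thus "Q (frag_of m)" for m
    by (simp add: frag_of_conv_mmon mmon_def)
qed (use assms in auto)

lemma meval_meval: "meval \<phi> (meval \<psi> P) = meval (\<lambda>i. meval \<phi> (\<psi> i)) P"
  by (induction P rule: mpoly_int_induct) (auto simp: meval_hom)

lemma meval_mvar_id [simp]: "meval mvar P = P"
  by (induction P rule: mpoly_int_induct) (auto simp: meval_hom)

lemma meval_ghost: "meval \<phi> (ghost p n x) = ghost p n (\<lambda>i. meval \<phi> (x i))"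
  by (simp add: ghost_def meval_hom flip: of_nat_power)

lemma diff_add_diff_cancel: "(a - b) + (b - c) = a - (c :: 'a::ab_group_add)"
  by simp

lemma dvd_diff_mult:
  fixes a b c d m :: "'a::comm_ring_1"
  assumes "m dvd a - b" "m dvd c - d"
  shows "m dvd a * c - b * d"
proof -
  have "a * c - b * d = (a - b) * c + b * (c - d)" by (simp add: algebra_simps)
  thus ?thesis using assms by (simp add: dvd_add)
qed

lemma freshmans_dream_dvd:
  fixes a b :: "'a::comm_ring_1"
  assumes p: "prime p"
  shows "of_nat p dvd (a + b) ^ p - (a ^ p + b ^ p)"
proof -
  have "p > 0" using p by (simp add: prime_gt_0_nat)
  have "(a + b) ^ p = (\<Sum>k\<le>p. of_nat (p choose k) * a ^ k * b ^ (p - k))"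
    by (rule binomial_ring)
  also have "{..p} = insert 0 (insert p ({..p} - {0,p}))" by auto
  also have "(\<Sum>k\<in>\<dots>. of_nat (p choose k) * a ^ k * b ^ (p - k)) = 
     b ^ p + a ^ p + (\<Sum>k\<in>{..p} - {0,p}. of_nat (p choose k) * a ^ k * b ^ (p - k))"
    using \<open>p > 0\<close> by simp
  finally have "(a + b) ^ p - (a ^ p + b ^ p) = (\<Sum>k\<in>{..p} - {0,p}. of_nat (p choose k) * a ^ k * b ^ (p - k))"
    by simp
  also have "of_nat p dvd \<dots>"
  proof (intro dvd_sum dvd_mult2)
    fix k assume "k \<in> {..p} - {0,p}"
    hence "p dvd p choose k" using p by (intro dvd_choose_prime) auto
    thus "(of_nat p :: 'a) dvd of_nat (p choose k)" by (elim dvdE) simp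
  qed
  finally show ?thesis .
qed

lemma dvd_diff_power_prime:
  fixes a b :: "'a::comm_ring_1"
  assumes p: "prime p" and k: "k > 0" and d: "of_nat p ^ k dvd a - b"
  shows "of_nat p ^ Suc k dvd a ^ p - b ^ p"
proof -
  from d obtain c where c: "a = b + of_nat p ^ k * c" by (metis dvdE diff_eq_eq add.commute)
  have "p > 1" using p by (rule prime_gt_1_nat)
  have "a ^ p = (\<Sum>j\<le>p. of_nat (p choose j) * (of_nat p ^ k * c) ^ j * b ^ (p - j))"
    unfolding c by (subst add.commute) (rule binomial_ring)
  also have "{..p} = insert 0 (insert 1 {2..p})" using \<open>p > 1\<close> by auto
  also have "(\<Sum>j\<in>\<dots>. of_nat (p choose j) * (of_nat p ^ k * c) ^ j * b ^ (p - j)) =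
      b ^ p + of_nat p ^ Suc k * c * b ^ (p - 1) +
      (\<Sum>j\<in>{2..p}. of_nat (p choose j) * (of_nat p ^ k * c) ^ j * b ^ (p - j))"
    by (simp add: mult_ac)
  finally have eq: "a ^ p - b ^ p = of_nat p ^ Suc k * (c * b ^ (p - 1)) + 
      (\<Sum>j\<in>{2..p}. of_nat (p choose j) * (of_nat p ^ k * c) ^ j * b ^ (p - j))"
    by (simp add: mult_ac)
  have "of_nat p ^ Suc k dvd (of_nat p ^ k * c) ^ j" if "j \<ge> 2" for j
  proof -
    have "Suc k \<le> k * 2" using k by simp
    also have "\<dots> \<le> k * j" using that by simp
    finally have "(of_nat p :: 'a) ^ Suc k dvd of_nat p ^ (k * j)" by (rule le_imp_power_dvd)
    thus ?thesis by (simp add: power_mult_distrib power_mult)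
  qed
  hence "of_nat p ^ Suc k dvd (\<Sum>j\<in>{2..p}. of_nat (p choose j) * (of_nat p ^ k * c) ^ j * b ^ (p - j))"
    by (intro dvd_sum dvd_mult2 dvd_mult) auto
  thus ?thesis unfolding eq by (intro dvd_add) auto
qed

lemma dvd_diff_power_prime_power:
  fixes a b :: "'a::comm_ring_1"
  assumes p: "prime p" and d: "of_nat p dvd a - b"
  shows "of_nat p ^ Suc k dvd a ^ (p ^ k) - b ^ (p ^ k)"
proof (induction k)
  case 0
  then show ?case using d by simp
next
  case (Suc k)
  from dvd_diff_power_prime[OF p _ Suc] show ?case
    by (simp add: power_mult [symmetric] mult.commute)
qed

definition frob :: "nat \<Rightarrow> mpoly_int \<Rightarrow> mpoly_int" where
  "frob p = meval (\<lambda>i. mvar i ^ p)"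

lemma frob_cong:
  assumes p: "prime p"
  shows "of_nat p dvd frob p P - P ^ p"
proof (induction P rule: mpoly_int_induct)
  case one
  then show ?case by (simp add: frob_def)
next
  case (var i)
  then show ?case by (simp add: frob_def)
next
  case (diff a b)
  have "of_nat p dvd ((a - b) + b) ^ p - ((a - b) ^ p + b ^ p)"
    by (rule freshmans_dream_dvd[OF p])
  hence "of_nat p dvd (frob p a - a ^ p) - (frob p b - b ^ p) + (((a - b) + b) ^ p - ((a - b) ^ p + b ^ p))"
    by (rule dvd_add[OF dvd_diff[OF diff]])
  thus ?case by (simp add: frob_def meval_diff algebra_simps)
next
  case (mult a b)
  then show ?case
    using dvd_diff_mult[OF mult] by (simp add: frob_def meval_mult power_mult_distrib)
qed

lemma of_nat_mpoly_nonzero [simp]: "prime p \<Longrightarrow> (of_nat p :: mpoly_int) \<noteq> 0"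
  by (simp add: prime_gt_0_nat)

lemma ghost_Suc_split: "ghost p n x = (\<Sum>i<n. of_nat p ^ i * x i ^ (p ^ (n - i))) + of_nat p ^ n * x n"
proof -
  have "{..n} = insert n {..<n}" by auto
  thus ?thesis by (simp add: ghost_def add_ac)
qed

lemma ghost_inj:
  fixes S T :: "nat \<Rightarrow> mpoly_int"
  assumes p: "prime p" and eq: "\<And>n. ghost p n S = ghost p n T"
  shows "S = T"
proof
  fix n show "S n = T n"
  proof (induction n rule: less_induct)
    case (less n)
    have "(\<Sum>i<n. of_nat p ^ i * S i ^ (p ^ (n - i))) = (\<Sum>i<n. of_nat p ^ i * T i ^ (p ^ (n - i)))"
      using less by (intro sum.cong) auto
    with eq[of n] have "(of_nat p :: mpoly_int) ^ n * S n = of_nat p ^ n * T n"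
      unfolding ghost_Suc_split by simp
    thus ?case using p by simp
  qed
qed

text \<open>Dwork's lemma for the polynomial ring with its Frobenius lift \<open>X\<^sub>i \<mapsto> X\<^sub>i\<^sup>p\<close>.\<close>

lemma dwork_step:
  fixes S :: "nat \<Rightarrow> mpoly_int"
  assumes p: "prime p"
  shows "of_nat p ^ Suc n dvd frob p (ghost p n S) - (\<Sum>i<Suc n. of_nat p ^ i * S i ^ (p ^ (Suc n - i)))"
proof -
  have "frob p (ghost p n S) - (\<Sum>i<Suc n. of_nat p ^ i * S i ^ (p ^ (Suc n - i))) =
        (\<Sum>i\<le>n. of_nat p ^ i * (frob p (S i) ^ (p ^ (n - i)) - (S i ^ p) ^ (p ^ (n - i))))"
  proof -
    have "(S i ^ p) ^ (p ^ (n - i)) = S i ^ (p ^ (Suc n - i))" if "i \<le> n" for i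
      using that by (simp add: Suc_diff_le flip: power_mult)
    moreover have "frob p (ghost p n S) = (\<Sum>i\<le>n. of_nat p ^ i * frob p (S i) ^ (p ^ (n - i)))"
      by (simp add: frob_def meval_ghost) (simp add: ghost_def)
    ultimately show ?thesis
      by (simp add: lessThan_Suc_atMost sum_subtractf right_diff_distrib)
  qed
  also have "of_nat p ^ Suc n dvd \<dots>"
  proof (rule dvd_sum)
    fix i assume i: "i \<in> {..n}"
    have "(of_nat p :: mpoly_int) ^ Suc n = of_nat p ^ i * of_nat p ^ Suc (n - i)"
      using i by (simp flip: power_add power_Suc)
    also have "\<dots> dvd of_nat p ^ i * (frob p (S i) ^ (p ^ (n - i)) - (S i ^ p) ^ (p ^ (n - i)))"
      by (intro mult_dvd_mono dvd_refl dvd_diff_power_prime_power p frob_cong)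
    finally show "of_nat p ^ Suc n dvd of_nat p ^ i * (frob p (S i) ^ (p ^ (n - i)) - (S i ^ p) ^ (p ^ (n - i)))" .
  qed
  finally show ?thesis .
qed

lemma dwork:
  fixes w :: "nat \<Rightarrow> mpoly_int"
  assumes p: "prime p" and w: "\<And>n. of_nat p ^ Suc n dvd w (Suc n) - frob p (w n)"
  shows "\<exists>!S. \<forall>n. ghost p n S = w n"
proof -
  have "\<exists>S. \<forall>n. (\<forall>i<n. ghost p i S = w i) \<longrightarrow>
      of_nat p ^ n * S n = w n - (\<Sum>i<n. of_nat p ^ i * S i ^ (p ^ (n - i)))"
  proof -
    define F where "F = (\<lambda>S n. SOME y. of_nat p ^ n * y = w n - (\<Sum>i<n. of_nat p ^ i * (S :: nat \<Rightarrow> mpoly_int) i ^ (p ^ (n - i))))"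
    define S where "S = wfrec less_than F"
    have F_cong: "F S n = F S' n" if "\<And>i. i < n \<Longrightarrow> S i = S' i" for S S' n
    proof -
      have "(\<Sum>i<n. of_nat p ^ i * S i ^ (p ^ (n - i))) = (\<Sum>i<n. of_nat p ^ i * S' i ^ (p ^ (n - i)))"
        using that by (intro sum.cong) auto
      thus ?thesis by (simp add: F_def)
    qed
    have S: "S n = F S n" for n
      unfolding S_def by (subst wfrec[OF wf_less_than]) (auto intro!: F_cong simp: cut_def)
    show ?thesis
    proof (intro exI[of _ S] allI impI)
      fix n assume IH: "\<forall>i<n. ghost p i S = w i"
      have "of_nat p ^ n dvd w n - (\<Sum>i<n. of_nat p ^ i * S i ^ (p ^ (n - i)))"
      proof (cases n)
        case (Suc m)
        have "ghost p m S = w m" using IH Suc by auto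
        with w[of m] dwork_step[OF p, of m S] have
          "of_nat p ^ Suc m dvd (w (Suc m) - frob p (w m)) + (frob p (w m) - (\<Sum>i<Suc m. of_nat p ^ i * S i ^ (p ^ (Suc m - i))))"
          by (intro dvd_add) auto
        also have "(w (Suc m) - frob p (w m)) + (frob p (w m) - (\<Sum>i<Suc m. of_nat p ^ i * S i ^ (p ^ (Suc m - i)))) =
            w (Suc m) - (\<Sum>i<Suc m. of_nat p ^ i * S i ^ (p ^ (Suc m - i)))"
          by (rule diff_add_diff_cancel)
        finally show ?thesis unfolding Suc .
      qed auto
      then obtain y where "w n - (\<Sum>i<n. of_nat p ^ i * S i ^ (p ^ (n - i))) = of_nat p ^ n * y"
        by (rule dvdE)
      hence "\<exists>y. of_nat p ^ n * y = w n - (\<Sum>i<n. of_nat p ^ i * S i ^ (p ^ (n - i)))"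
        by (intro exI) (rule sym)
      from someI_ex[OF this] show "of_nat p ^ n * S n = w n - (\<Sum>i<n. of_nat p ^ i * S i ^ (p ^ (n - i)))"
        by (subst S) (simp add: F_def)
    qed
  qed
  then obtain S where S: "\<And>n. (\<forall>i<n. ghost p i S = w i) \<Longrightarrow>
      of_nat p ^ n * S n = w n - (\<Sum>i<n. of_nat p ^ i * S i ^ (p ^ (n - i)))" by blast
  have "ghost p n S = w n" for n
    by (induction n rule: less_induct) (simp add: ghost_Suc_split S)
  thus ?thesis
    by (auto intro: ghost_inj[OF p])
qed

lemma ghost_frob_dvd:
  fixes x :: "nat \<Rightarrow> mpoly_int"
  assumes p: "prime p"
  shows "of_nat p ^ Suc n dvd ghost p (Suc n) x - frob p (ghost p n x)"
proof -
  have "of_nat p ^ Suc n dvd of_nat p ^ Suc n * x (Suc n) - (frob p (ghost p n x) - (\<Sum>i<Suc n. of_nat p ^ i * x i ^ (p ^ (Suc n - i))))"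
    by (intro dvd_diff dwork_step p) auto
  thus ?thesis unfolding ghost_Suc_split[of p "Suc n"] by (simp add: algebra_simps)
qed

text \<open>The universal Witt polynomials. For prime \<open>p\<close> they exist and are unique by Dwork's lemma.
  The variables of the first operand are the even ones, those of the second operand the odd ones.\<close>

definition witt_add_poly :: "nat \<Rightarrow> nat \<Rightarrow> mpoly_int" where
  "witt_add_poly p = (THE S. \<forall>n. ghost p n S = 
     ghost p n (\<lambda>i. mvar (2 * i)) + ghost p n (\<lambda>i. mvar (2 * i + 1)))"

definition witt_mult_poly :: "nat \<Rightarrow> nat \<Rightarrow> mpoly_int" where
  "witt_mult_poly p = (THE S. \<forall>n. ghost p n S = 
     ghost p n (\<lambda>i. mvar (2 * i)) * ghost p n (\<lambda>i. mvar (2 * i + 1)))"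

definition witt_neg_poly :: "nat \<Rightarrow> nat \<Rightarrow> mpoly_int" where
  "witt_neg_poly p = (THE S. \<forall>n. ghost p n S = - ghost p n mvar)"

lemma ghost_witt_add_poly:
  assumes p: "prime p"
  shows "ghost p n (witt_add_poly p) = ghost p n (\<lambda>i. mvar (2 * i)) + ghost p n (\<lambda>i. mvar (2 * i + 1))"
proof -
  have "\<exists>!S. \<forall>n. ghost p n S = ghost p n (\<lambda>i. mvar (2 * i)) + ghost p n (\<lambda>i. mvar (2 * i + 1))"
  proof (rule dwork[OF p])
    fix n
    show "of_nat p ^ Suc n dvd ghost p (Suc n) (\<lambda>i. mvar (2 * i)) + ghost p (Suc n) (\<lambda>i. mvar (2 * i + 1)) -
       frob p (ghost p n (\<lambda>i. mvar (2 * i)) + ghost p n (\<lambda>i. mvar (2 * i + 1)))"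
      using dvd_add[OF ghost_frob_dvd[OF p, of n "\<lambda>i. mvar (2 * i)"] ghost_frob_dvd[OF p, of n "\<lambda>i. mvar (2 * i + 1)"]]
      by (simp add: frob_def meval_add algebra_simps)
  qed
  from theI'[OF this] show ?thesis by (simp add: witt_add_poly_def)
qed

lemma ghost_witt_mult_poly:
  assumes p: "prime p"
  shows "ghost p n (witt_mult_poly p) = ghost p n (\<lambda>i. mvar (2 * i)) * ghost p n (\<lambda>i. mvar (2 * i + 1))"
proof -
  have "\<exists>!S. \<forall>n. ghost p n S = ghost p n (\<lambda>i. mvar (2 * i)) * ghost p n (\<lambda>i. mvar (2 * i + 1))"
  proof (rule dwork[OF p])
    fix n
    show "of_nat p ^ Suc n dvd ghost p (Suc n) (\<lambda>i. mvar (2 * i)) * ghost p (Suc n) (\<lambda>i. mvar (2 * i + 1)) -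
       frob p (ghost p n (\<lambda>i. mvar (2 * i)) * ghost p n (\<lambda>i. mvar (2 * i + 1)))"
      using dvd_diff_mult[OF ghost_frob_dvd[OF p, of n "\<lambda>i. mvar (2 * i)"] ghost_frob_dvd[OF p, of n "\<lambda>i. mvar (2 * i + 1)"]]
      by (simp add: frob_def meval_mult)
  qed
  from theI'[OF this] show ?thesis by (simp add: witt_mult_poly_def)
qed

lemma ghost_witt_neg_poly:
  assumes p: "prime p"
  shows "ghost p n (witt_neg_poly p) = - ghost p n mvar"
proof -
  have "\<exists>!S. \<forall>n. ghost p n S = - ghost p n mvar"
  proof (rule dwork[OF p])
    fix n
    have "of_nat p ^ Suc n dvd - (ghost p (Suc n) mvar - frob p (ghost p n mvar))"
      using ghost_frob_dvd[OF p, of n mvar] by (simp only: dvd_minus_iff)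
    thus "of_nat p ^ Suc n dvd - ghost p (Suc n) mvar - frob p (- ghost p n mvar)"
      by (simp add: frob_def meval_uminus)
  qed
  from theI'[OF this] show ?thesis by (simp add: witt_neg_poly_def)
qed

definition interleave :: "(nat \<Rightarrow> 'a) \<Rightarrow> (nat \<Rightarrow> 'a) \<Rightarrow> nat \<Rightarrow> 'a" where
  "interleave x y j = (if even j then x (j div 2) else y (j div 2))"

definition wadd :: "nat \<Rightarrow> (nat \<Rightarrow> 'a::comm_ring_1) \<Rightarrow> (nat \<Rightarrow> 'a) \<Rightarrow> nat \<Rightarrow> 'a" where
  "wadd p x y n = meval (interleave x y) (witt_add_poly p n)"

definition wmult :: "nat \<Rightarrow> (nat \<Rightarrow> 'a::comm_ring_1) \<Rightarrow> (nat \<Rightarrow> 'a) \<Rightarrow> nat \<Rightarrow> 'a" where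
  "wmult p x y n = meval (interleave x y) (witt_mult_poly p n)"

definition wneg :: "nat \<Rightarrow> (nat \<Rightarrow> 'a::comm_ring_1) \<Rightarrow> nat \<Rightarrow> 'a" where
  "wneg p x n = meval x (witt_neg_poly p n)"

lemma ghost_wadd: "prime p \<Longrightarrow> ghost p n (wadd p x y) = ghost p n x + ghost p n y"
  using arg_cong[OF ghost_witt_add_poly[of p n], of "meval (interleave x y)"]
  by (simp add: wadd_def[abs_def] meval_ghost meval_add interleave_def)

lemma ghost_wmult: "prime p \<Longrightarrow> ghost p n (wmult p x y) = ghost p n x * ghost p n y"
  using arg_cong[OF ghost_witt_mult_poly[of p n], of "meval (interleave x y)"]
  by (simp add: wmult_def[abs_def] meval_ghost meval_mult interleave_def)

lemma ghost_wneg: "prime p \<Longrightarrow> ghost p n (wneg p x) = - ghost p n x"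
  using arg_cong[OF ghost_witt_neg_poly[of p n], of "meval x"]
  by (simp add: wneg_def[abs_def] meval_ghost meval_uminus)

lemma meval_interleave: "meval \<phi> (interleave x y j) = interleave (\<lambda>i. meval \<phi> (x i)) (\<lambda>i. meval \<phi> (y i)) j"
  by (simp add: interleave_def)

lemma meval_wadd: "meval \<phi> (wadd p x y n) = wadd p (\<lambda>i. meval \<phi> (x i)) (\<lambda>i. meval \<phi> (y i)) n"
  by (simp add: wadd_def meval_meval meval_interleave)

lemma meval_wmult: "meval \<phi> (wmult p x y n) = wmult p (\<lambda>i. meval \<phi> (x i)) (\<lambda>i. meval \<phi> (y i)) n"
  by (simp add: wmult_def meval_meval meval_interleave)

lemma meval_wneg: "meval \<phi> (wneg p x n) = wneg p (\<lambda>i. meval \<phi> (x i)) n"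
  by (simp add: wneg_def meval_meval)

lemma ghost_0 [simp]: "prime p \<Longrightarrow> ghost p n (\<lambda>_. 0) = 0"
  by (simp add: ghost_def power_0_left prime_gt_0_nat)

lemma ghost_1 [simp]: "prime p \<Longrightarrow> ghost p n (\<lambda>i. if i = 0 then 1 else 0) = 1"
  by (simp add: ghost_def power_0_left prime_gt_0_nat if_distrib[of "\<lambda>x. x ^ _"] if_distrib[of "\<lambda>x. _ * x"] cong: if_cong)

lemmas ghost_ops = ghost_wadd ghost_wmult ghost_wneg ghost_0 ghost_1

lemma generic3:
  fixes x y z :: "nat \<Rightarrow> 'a::comm_ring_1"
  shows "\<exists>\<phi>. \<forall>i. \<phi> (3 * i) = x i \<and> \<phi> (3 * i + 1) = y i \<and> \<phi> (3 * i + 2) = z i"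
proof (intro exI allI conjI)
  let ?\<phi> = "\<lambda>j. if j mod 3 = 0 then x (j div 3) else if j mod 3 = 1 then y (j div 3) else z (j div 3)"
  fix i :: nat
  have 1: "(3 * i + 1) mod 3 = 1" "(3 * i + 1) div 3 = i" and 2: "(3 * i + 2) mod 3 = 2" "(3 * i + 2) div 3 = i"
    by presburger+
  show "?\<phi> (3 * i) = x i" by simp
  show "?\<phi> (3 * i + 1) = y i" unfolding 1 by simp
  show "?\<phi> (3 * i + 2) = z i" unfolding 2 by simp
qed

lemma witt_ring_identities:
  fixes x y z :: "nat \<Rightarrow> 'a::comm_ring_1"
  assumes p: "prime p"
  shows "wadd p (wadd p x y) z = wadd p x (wadd p y z)"
    and "wadd p x y = wadd p y x"
    and "wadd p (\<lambda>_. 0) x = x"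
    and "wadd p (wneg p x) x = (\<lambda>_. 0)"
    and "wmult p (wmult p x y) z = wmult p x (wmult p y z)"
    and "wmult p x y = wmult p y x"
    and "wmult p (\<lambda>i. if i = 0 then 1 else 0) x = x"
    and "wmult p (wadd p x y) z = wadd p (wmult p x z) (wmult p y z)"
proof -
  define a b c where "a = (\<lambda>i. mvar (3 * i))" and "b = (\<lambda>i. mvar (3 * i + 1))" and "c = (\<lambda>i. mvar (3 * i + 2))"
  obtain \<phi> where \<phi>: "\<And>i. \<phi> (3 * i) = x i" "\<And>i. \<phi> (3 * i + 1) = y i" "\<And>i. \<phi> (3 * i + 2) = z i"
    using generic3[of x y z] by blast
  have ev: "(\<lambda>i. meval \<phi> (a i)) = x" "(\<lambda>i. meval \<phi> (b i)) = y" "(\<lambda>i. meval \<phi> (c i)) = z"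
    using \<phi> by (auto simp: a_def b_def c_def)
  have ev1: "(\<lambda>i. meval \<phi> (if i = 0 then 1 else 0)) = (\<lambda>i::nat. if i = 0 then 1 else 0)" by auto
  have transfer: "(\<lambda>i. meval \<phi> (S i)) = (\<lambda>i. meval \<phi> (T i))" if "\<And>n. ghost p n S = ghost p n T" for S T
    using ghost_inj[OF p that] by simp
  note [simp] = ghost_ops p
  show "wadd p (wadd p x y) z = wadd p x (wadd p y z)"
    using transfer[of "wadd p (wadd p a b) c" "wadd p a (wadd p b c)"]
    by (simp add: meval_wadd[abs_def] ev add_ac)
  show "wadd p x y = wadd p y x"
    using transfer[of "wadd p a b" "wadd p b a"] by (simp add: meval_wadd[abs_def] ev add_ac)
  show "wadd p (\<lambda>_. 0) x = x"
    using transfer[of "wadd p (\<lambda>_. 0) a" "a"] by (simp add: meval_wadd[abs_def] ev add_ac)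
  show "wadd p (wneg p x) x = (\<lambda>_. 0)"
    using transfer[of "wadd p (wneg p a) a" "\<lambda>_. 0"] by (simp add: meval_wadd[abs_def] meval_wneg[abs_def] ev add_ac)
  show "wmult p (wmult p x y) z = wmult p x (wmult p y z)"
    using transfer[of "wmult p (wmult p a b) c" "wmult p a (wmult p b c)"]
    by (simp add: meval_wmult[abs_def] ev mult_ac)
  show "wmult p x y = wmult p y x"
    using transfer[of "wmult p a b" "wmult p b a"] by (simp add: meval_wmult[abs_def] ev mult_ac)
  show "wmult p (\<lambda>i. if i = 0 then 1 else 0) x = x"
    using transfer[of "wmult p (\<lambda>i. if i = 0 then 1 else 0) a" "a"]
    by (simp add: meval_wmult[abs_def] ev ev1 mult_ac)
  show "wmult p (wadd p x y) z = wadd p (wmult p x z) (wmult p y z)"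
    using transfer[of "wmult p (wadd p a b) c" "wadd p (wmult p a c) (wmult p b c)"]
    by (simp add: meval_wmult[abs_def] meval_wadd[abs_def] ev algebra_simps)
qed

lemma wmult_leading_mpoly:
  fixes a b :: "nat \<Rightarrow> mpoly_int"
  assumes p: "prime p" and a: "\<And>i. i < m \<Longrightarrow> a i = 0" and b: "\<And>i. i < n \<Longrightarrow> b i = 0"
  shows "of_nat p dvd wmult p a b (m + n) - a m ^ (p ^ n) * b n ^ (p ^ m)"
proof -
  define M where "M = wmult p a b"
  have "p > 0" using p by (rule prime_gt_0_nat)
  have lead: "of_nat p ^ k dvd ghost p r c \<and> (k \<le> r \<longrightarrow> of_nat p ^ Suc k dvd ghost p r c - of_nat p ^ k * c k ^ (p ^ (r - k)))"
    if "\<And>i. i < k \<Longrightarrow> c i = 0" for k r and c :: "nat \<Rightarrow> mpoly_int"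
  proof -
    have *: "of_nat p ^ j dvd (\<Sum>i\<in>A. of_nat p ^ i * c i ^ (p ^ (r - i)))" if "A \<subseteq> {j..}" for A j
      using that by (intro dvd_sum dvd_mult2 le_imp_power_dvd) auto
    have eq: "ghost p r c = (\<Sum>i\<in>{k..r}. of_nat p ^ i * c i ^ (p ^ (r - i)))"
      unfolding ghost_def
      by (rule sum.mono_neutral_right) (use that \<open>p > 0\<close> in \<open>auto simp: power_0_left\<close>)
    moreover have "ghost p r c - of_nat p ^ k * c k ^ (p ^ (r - k)) = (\<Sum>i\<in>{Suc k..r}. of_nat p ^ i * c i ^ (p ^ (r - i)))"
      if "k \<le> r"
      using that unfolding eq by (simp add: sum.atLeast_Suc_atMost)
    ultimately show ?thesis
      using *[of "{k..r}" k] *[of "{Suc k..r}" "Suc k"] by auto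
  qed
  have la: "of_nat p ^ m dvd ghost p r a" and lb: "of_nat p ^ n dvd ghost p r b" for r
    using lead[of m a r, OF a] lead[of n b r, OF b] by auto
  have tail: "of_nat p ^ Suc r dvd (\<Sum>i<r. of_nat p ^ i * M i ^ (p ^ (r - i)))"
    if "\<And>i. i < r \<Longrightarrow> of_nat p dvd M i" for r
  proof (rule dvd_sum)
    fix i assume i: "i \<in> {..<r}"
    have "r - i < p ^ (r - i)" using prime_gt_1_nat[OF p] by (simp add: power_gt_expt)
    hence "Suc r \<le> i + p ^ (r - i)" using i by auto
    hence "(of_nat p :: mpoly_int) ^ Suc r dvd of_nat p ^ i * of_nat p ^ (p ^ (r - i))"
      by (simp only: le_imp_power_dvd flip: power_add)
    also have "\<dots> dvd of_nat p ^ i * M i ^ (p ^ (r - i))"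
      using that i by (intro mult_dvd_mono dvd_power_same) auto
    finally show "of_nat p ^ Suc r dvd of_nat p ^ i * M i ^ (p ^ (r - i))" .
  qed
  have ghM: "of_nat p ^ r * M r = ghost p r a * ghost p r b - (\<Sum>i<r. of_nat p ^ i * M i ^ (p ^ (r - i)))" for r
    using ghost_wmult[OF p, of r a b] unfolding M_def ghost_Suc_split[of p r "wmult p a b"]
    by (simp add: algebra_simps)
  have cancel: "of_nat p dvd x" if "of_nat p ^ Suc r dvd of_nat p ^ r * x" for r and x :: mpoly_int
    using that p by simp
  have low: "of_nat p dvd M r" if "r < m + n" for r
    using that
  proof (induction r rule: less_induct)
    case (less r)
    have "(of_nat p :: mpoly_int) ^ Suc r dvd of_nat p ^ (m + n)"
      using less.prems by (intro le_imp_power_dvd) auto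
    also have "of_nat p ^ (m + n) dvd ghost p r a * ghost p r b"
      unfolding power_add by (intro mult_dvd_mono la lb)
    finally have "of_nat p ^ Suc r dvd of_nat p ^ r * M r"
      unfolding ghM using less by (intro dvd_diff tail) auto
    thus ?case by (rule cancel)
  qed
  define r where "r = m + n"
  define A B where "A = a m ^ (p ^ n)" and "B = b n ^ (p ^ m)"
  have "of_nat p ^ Suc m dvd ghost p r a - of_nat p ^ m * A"
    using lead[of m a r, OF a] by (simp add: A_def r_def)
  then obtain u where "ghost p r a - of_nat p ^ m * A = of_nat p ^ Suc m * u"
    by (rule dvdE)
  hence u: "ghost p r a = of_nat p ^ m * A + of_nat p ^ Suc m * u"
    by (simp only: diff_eq_eq add.commute)
  have "of_nat p ^ Suc n dvd ghost p r b - of_nat p ^ n * B"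
    using lead[of n b r, OF b] by (simp add: B_def r_def)
  then obtain v where "ghost p r b - of_nat p ^ n * B = of_nat p ^ Suc n * v"
    by (rule dvdE)
  hence v: "ghost p r b = of_nat p ^ n * B + of_nat p ^ Suc n * v"
    by (simp only: diff_eq_eq add.commute)
  have "ghost p r a * ghost p r b - of_nat p ^ r * (A * B) =
      of_nat p ^ Suc r * (u * B + A * v + of_nat p * u * v)"
    by (simp only: u v) (simp add: r_def algebra_simps power_add)
  hence "of_nat p ^ Suc r dvd ghost p r a * ghost p r b - of_nat p ^ r * (A * B)"
    by (metis dvd_triv_left)
  from dvd_diff[OF this tail[of r]] low
  have "of_nat p ^ Suc r dvd of_nat p ^ r * (M r - A * B)"
    by (simp only: r_def right_diff_distrib ghM) (simp only: diff_diff_eq add.commute)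
  from cancel[OF this] show ?thesis by (simp add: M_def A_def B_def r_def)
qed

lemma wmult_leading:
  fixes x y :: "nat \<Rightarrow> 'a::comm_ring_prime_char"
  assumes x: "\<And>i. i < m \<Longrightarrow> x i = 0" and y: "\<And>i. i < n \<Longrightarrow> y i = 0"
  shows "wmult CHAR('a) x y (m + n) = x m ^ (CHAR('a) ^ n) * y n ^ (CHAR('a) ^ m)"
proof -
  define a b :: "nat \<Rightarrow> mpoly_int" where "a = (\<lambda>i. if i < m then 0 else mvar (2 * i))"
    and "b = (\<lambda>i. if i < n then 0 else mvar (2 * i + 1))"
  let ?ev = "meval (interleave x y)"
  have ev: "(\<lambda>i. ?ev (a i)) = x" "(\<lambda>i. ?ev (b i)) = y"
    using x y by (auto simp: a_def b_def interleave_def)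
  have "of_nat CHAR('a) dvd wmult CHAR('a) a b (m + n) - a m ^ (CHAR('a) ^ n) * b n ^ (CHAR('a) ^ m)"
    by (rule wmult_leading_mpoly) (auto simp: a_def b_def)
  then obtain c where "wmult CHAR('a) a b (m + n) - a m ^ (CHAR('a) ^ n) * b n ^ (CHAR('a) ^ m) = of_nat CHAR('a) * c"
    by (auto elim: dvdE)
  from arg_cong[OF this, of ?ev] show ?thesis
    by (simp add: meval_hom meval_wmult ev fun_cong[OF ev(1)] fun_cong[OF ev(2)])
qed

text \<open>The \<open>p\<close>-typical Witt vectors, where \<open>p\<close> is the characteristic of the base ring.\<close>

datatype 'a witt = Witt (witt_nth: "nat \<Rightarrow> 'a")

instantiation witt :: (comm_ring_prime_char) comm_ring_1
begin

definition "0 = Witt (\<lambda>_. 0)"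
definition "1 = Witt (\<lambda>i. if i = 0 then 1 else 0)"
definition "x + y = Witt (wadd CHAR('a) (witt_nth x) (witt_nth y))"
definition "x * y = Witt (wmult CHAR('a) (witt_nth x) (witt_nth y))"
definition "- x = Witt (wneg CHAR('a) (witt_nth x))"
definition "x - y = x + - (y :: 'a witt)"

instance
proof
  note [simp] = zero_witt_def one_witt_def plus_witt_def times_witt_def uminus_witt_def minus_witt_def
  fix x y z :: "'a witt"
  show "x + y + z = x + (y + z)" by (simp add: witt_ring_identities(1))
  show "x + y = y + x" by (simp add: witt_ring_identities(2)[of _ "witt_nth x"])
  show "0 + x = x" by (simp add: witt_ring_identities(3))
  show "- x + x = 0" by (simp add: witt_ring_identities(4))
  show "x - y = x + - y" by simp
  show "x * y * z = x * (y * z)" by (simp add: witt_ring_identities(5))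
  show "x * y = y * x" by (simp add: witt_ring_identities(6)[of _ "witt_nth x"])
  show "1 * x = x" by (simp add: witt_ring_identities(7))
  show "(x + y) * z = x * z + y * z" by (simp add: witt_ring_identities(8))
  show "(0 :: 'a witt) \<noteq> 1" by (simp add: fun_eq_iff)
qed

end

instance witt :: (idom_prime_char) idom
proof
  fix x y :: "'a witt"
  assume "x \<noteq> 0" "y \<noteq> 0"
  hence ex: "\<exists>m. witt_nth x m \<noteq> 0" "\<exists>n. witt_nth y n \<noteq> 0"
    by (metis zero_witt_def witt.exhaust_sel ext)+
  define m n where "m = (LEAST m. witt_nth x m \<noteq> 0)" and "n = (LEAST n. witt_nth y n \<noteq> 0)"
  have "witt_nth (x * y) (m + n) = witt_nth x m ^ (CHAR('a) ^ n) * witt_nth y n ^ (CHAR('a) ^ m)"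
    unfolding times_witt_def m_def n_def witt.sel
    by (rule wmult_leading) (blast dest: not_less_Least)+
  also have "\<dots> \<noteq> 0"
    using LeastI_ex[OF ex(1)] LeastI_ex[OF ex(2)] by (simp add: m_def n_def)
  finally show "x * y \<noteq> 0" by (auto simp: zero_witt_def)
qed

definition witt_red :: "'a witt \<Rightarrow> 'a" where
  "witt_red w = witt_nth w 0"

lemma witt_red_hom [simp]:
  fixes v w :: "'a::comm_ring_prime_char witt"
  shows "witt_red 0 = (0 :: 'a)" "witt_red 1 = (1 :: 'a)"
    "witt_red (v + w) = witt_red v + witt_red w" "witt_red (v * w) = witt_red v * witt_red w"
  using ghost_wadd[of "CHAR('a)" 0 "witt_nth v" "witt_nth w"]
    ghost_wmult[of "CHAR('a)" 0 "witt_nth v" "witt_nth w"]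
  by (simp_all add: witt_red_def zero_witt_def one_witt_def plus_witt_def times_witt_def ghost_def)

text \<open>All extensions of \<open>W(k)\<close> are taken inside an algebraic closure of its field of fractions.\<close>

definition witt_emb :: "'a::idom_prime_char witt \<Rightarrow> 'a witt fract alg_closure" where
  "witt_emb w = to_ac (to_fract w)"

definition subring_generated :: "'a::comm_ring_1 set \<Rightarrow> 'a set" where
  "subring_generated S = \<Inter>{R. S \<subseteq> R \<and> 1 \<in> R \<and> (\<forall>a\<in>R. \<forall>b\<in>R. a - b \<in> R \<and> a * b \<in> R)}"

definition witt_adjoin ::
    "'a::idom_prime_char witt fract alg_closure set \<Rightarrow> 'a witt fract alg_closure set" where
  "witt_adjoin S = subring_generated (range witt_emb \<union> S)"

text \<open>Reduction modulo \<open>p\<close> on a ring \<open>B\<close> between \<open>W(k)\<close> and the algebraic closure: a ring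
  homomorphism \<open>B \<rightarrow> k\<close> with kernel \<open>pB\<close> that extends the reduction \<open>W(k) \<rightarrow> k\<close>.\<close>

definition reduction_mod_p ::
    "'a::idom_prime_char witt fract alg_closure set \<Rightarrow> ('a witt fract alg_closure \<Rightarrow> 'a) \<Rightarrow> bool" where
  "reduction_mod_p B \<rho> \<longleftrightarrow>
     (\<forall>a\<in>B. \<forall>b\<in>B. \<rho> (a + b) = \<rho> a + \<rho> b \<and> \<rho> (a * b) = \<rho> a * \<rho> b) \<and>
     (\<forall>w. \<rho> (witt_emb w) = witt_red w) \<and>
     {b\<in>B. \<rho> b = 0} = (\<lambda>b. of_nat CHAR('a) * b) ` B"

definition is_algebraic_closure :: "('a::field \<Rightarrow> 'b::alg_closed_field) \<Rightarrow> bool" where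
  "is_algebraic_closure \<iota> \<longleftrightarrow>
     \<iota> 1 = 1 \<and> (\<forall>a b. \<iota> (a + b) = \<iota> a + \<iota> b \<and> \<iota> (a * b) = \<iota> a * \<iota> b) \<and>
     (\<forall>x. \<exists>P. P \<noteq> 0 \<and> poly (map_poly \<iota> P) x = 0)"

text \<open>A monic cubic \<open>f\<close> stands for the curve \<open>y\<^sup>2 = f(x)\<close>. Away from characteristic 2 every
  elliptic curve over a field, or over \<open>W(k)\<close>, has such an equation.\<close>

datatype 'a ec_point = Infinity | Aff 'a 'a

definition affine_points :: "'a::comm_ring_1 set \<Rightarrow> 'a poly \<Rightarrow> 'a ec_point set" where
  "affine_points B f = {Aff x y | x y. x \<in> B \<and> y \<in> B \<and> y ^ 2 = poly f x}"

definition ec_points :: "'a::field poly \<Rightarrow> 'a ec_point set" where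
  "ec_points f = insert Infinity (affine_points UNIV f)"

text \<open>The chord--tangent law on \<open>y\<^sup>2 = x\<^sup>3 + a\<^sub>2x\<^sup>2 + a\<^sub>4x + a\<^sub>6\<close>; a line of slope \<open>s\<close> meets the curve
  in three points whose \<open>x\<close>-coordinates sum to \<open>s\<^sup>2 - a\<^sub>2\<close>.\<close>

fun ec_add :: "'a::field poly \<Rightarrow> 'a ec_point \<Rightarrow> 'a ec_point \<Rightarrow> 'a ec_point" where
  "ec_add f Infinity Q = Q"
| "ec_add f P Infinity = P"
| "ec_add f (Aff x1 y1) (Aff x2 y2) =
    (if x1 = x2 \<and> y1 = - y2 then Infinity
     else let s = (if x1 = x2 then poly (pderiv f) x1 / (2 * y1) else (y2 - y1) / (x2 - x1));
              x3 = s ^ 2 - coeff f 2 - x1 - x2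
          in Aff x3 (s * (x1 - x3) - y1))"

definition ec_mult :: "'a::field poly \<Rightarrow> nat \<Rightarrow> 'a ec_point \<Rightarrow> 'a ec_point" where
  "ec_mult f n P = (ec_add f P ^^ n) Infinity"

definition ec_primary_torsion :: "nat \<Rightarrow> 'a::field poly \<Rightarrow> 'a ec_point set" where
  "ec_primary_torsion p f = {P \<in> ec_points f. \<exists>m. ec_mult f (p ^ m) P = Infinity}"

definition elliptic :: "'a::field poly \<Rightarrow> bool" where
  "elliptic f \<longleftrightarrow> degree f = 3 \<and> lead_coeff f = 1 \<and> coprime f (pderiv f)"

definition ordinary :: "'a::{alg_closed_field, field_prime_char} poly \<Rightarrow> bool" where
  "ordinary f \<longleftrightarrow> (\<exists>P\<in>ec_points f. P \<noteq> Infinity \<and> ec_mult f CHAR('a) P = Infinity)"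

definition is_lift :: "'a::field_prime_char witt poly \<Rightarrow> 'a poly \<Rightarrow> bool" where
  "is_lift F f \<longleftrightarrow> degree F = 3 \<and> lead_coeff F = 1 \<and> map_poly witt_red F = f"

text \<open>By properness \<open>E(W(k)) = E(K)\<close> with \<open>K\<close> the field of fractions of \<open>W(k)\<close>. An affine point
  over \<open>K\<close> has either two integral coordinates or none, and in the second case it reduces to the
  point at infinity.\<close>

fun reduce_point :: "'a::field_prime_char witt fract ec_point \<Rightarrow> 'a ec_point" where
  "reduce_point Infinity = Infinity"
| "reduce_point (Aff x y) =
    (if x \<in> range to_fract \<and> y \<in> range to_fract
     then Aff (witt_red (inv_into UNIV to_fract x)) (witt_red (inv_into UNIV to_fract y)) else Infinity)"

text \<open>The Serre--Tate canonical lift of an ordinary curve \<open>E\<close> is the lift \<open>E'\<close> for which the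
  connected--etale sequence of the \<open>p\<close>-divisible group \<open>E'[p\<^sup>\<infinity>]\<close> splits. Over an algebraically
  closed \<open>k\<close> the etale quotient is the constant group \<open>E[p\<^sup>\<infinity>](k)\<close>, so a splitting is a homomorphism
  \<open>\<sigma>\<close> from \<open>E[p\<^sup>\<infinity>](k)\<close> to the \<open>p\<close>-primary torsion of \<open>E'(W(k))\<close> which is a section of the reduction map.\<close>

definition is_canonical_lift ::
    "'a::{alg_closed_field, field_prime_char} witt poly \<Rightarrow> 'a poly \<Rightarrow> bool" where
  "is_canonical_lift F f \<longleftrightarrow>
     elliptic f \<and> ordinary f \<and> is_lift F f \<and>
     (let T = ec_primary_torsion CHAR('a) f; F' = map_poly to_fract F in
       \<exists>\<sigma>. (\<forall>P\<in>T. \<sigma> P \<in> ec_primary_torsion CHAR('a) F' \<and> reduce_point (\<sigma> P) = P) \<and>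
           (\<forall>P\<in>T. \<forall>Q\<in>T. \<sigma> (ec_add f P Q) = ec_add F' (\<sigma> P) (\<sigma> Q)))"

definition legendre :: "'a::comm_ring_1 \<Rightarrow> 'a poly" where
  "legendre l = [:0, 1:] * [:1, 1:] * [:l, 1:]"

definition canonical_legendre_coordinate ::
    "'a::{alg_closed_field, field_prime_char} \<Rightarrow> 'a witt \<Rightarrow> bool" where
  "canonical_legendre_coordinate l w \<longleftrightarrow>
     witt_red w = l \<and> is_canonical_lift (legendre w) (legendre l)"

end

theory Submission
  imports Defs
begin

text \<open>
  The lifted point already has coordinates in \<open>W(k)\<close>. Since \<open>n\<close> is \<open>1\<close> modulo \<open>p\<close> and \<open>t\<close> is not \<open>0\<close>,
  Hensel's lemma lifts \<open>u\<close> to an \<open>n\<close>-th root \<open>U\<close> of the canonical coordinate in \<open>W(k)\<close>. Write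
  \<open>p\<^sup>f = 2m + 1\<close>. As \<open>u + 1\<close> is not \<open>0\<close>, the quotient of \<open>U\<^bsup>2m+1\<^esup> + 1\<close> by \<open>U + 1\<close> is a unit of \<open>W(k)\<close>;
  it reduces to the square \<open>(u + 1)\<^bsup>2m\<^esup>\<close> because raising to the power \<open>p\<^sup>f\<close> is additive in \<open>k\<close>, so for
  odd \<open>p\<close> Hensel's lemma also lifts the square root \<open>(u + 1)\<^sup>m\<close>. Hence \<open>B = W(k)\<close> with its usual
  reduction, whose kernel is \<open>pB\<close> because \<open>k\<close> is perfect.
\<close>

section \<open>Divisibility by \<open>p\<close> and completeness\<close>

lemma witt_eqI: "(\<And>i. witt_nth x i = witt_nth y i) \<Longrightarrow> x = y"
  by (cases x; cases y) auto

lemma witt_nth_0 [simp]: "witt_nth 0 i = 0"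
  by (simp add: zero_witt_def)

text \<open>By induction the terms with \<open>i < n\<close> agree modulo \<open>p ^ Suc n\<close>:
  a congruence modulo \<open>p\<close> gains one factor \<open>p\<close> with each
  \<open>p\<close>-th power. What remains is the top term, from which \<open>p ^ n\<close>
  cancels.\<close>

lemma ghost_cong_imp_cong:
  fixes x y :: "nat \<Rightarrow> mpoly_int"
  assumes p: "prime p" and eq: "\<And>n. of_nat p ^ Suc n dvd ghost p n x - ghost p n y"
  shows "of_nat p dvd x n - y n"
proof (induction n rule: less_induct)
  case (less n)
  have "of_nat p ^ Suc n dvd
      (\<Sum>i<n. of_nat p ^ i * (x i ^ (p ^ (n - i)) - y i ^ (p ^ (n - i))))"
  proof (rule dvd_sum)
    fix i assume i: "i \<in> {..<n}"
    have "(of_nat p :: mpoly_int) ^ Suc n = of_nat p ^ i * of_nat p ^ Suc (n - i)"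
      using i by (simp flip: power_add power_Suc)
    also have "\<dots> dvd of_nat p ^ i * (x i ^ (p ^ (n - i)) - y i ^ (p ^ (n - i)))"
      using i by (intro mult_dvd_mono dvd_refl dvd_diff_power_prime_power p less) auto
    finally show "of_nat p ^ Suc n dvd of_nat p ^ i * (x i ^ (p ^ (n - i)) - y i ^ (p ^ (n - i)))" .
  qed
  from dvd_diff[OF eq[of n] this]
  have "(of_nat p :: mpoly_int) ^ Suc n dvd of_nat p ^ n * (x n - y n)"
    unfolding ghost_Suc_split by (simp add: right_diff_distrib sum_subtractf)
  thus ?case using p by simp
qed

text \<open>One of the two entries vanishes at each index, so powers of the componentwise sum split
  without cross terms, and its ghost components are the right ones.\<close>

lemma wadd_disjoint_mpoly:
  fixes a b :: "nat \<Rightarrow> mpoly_int"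
  assumes p: "prime p" and disj: "\<And>i. a i = 0 \<or> b i = 0"
  shows "wadd p a b = (\<lambda>i. a i + b i)"
proof (rule ghost_inj[OF p])
  fix n
  have "a i ^ (p ^ k) + b i ^ (p ^ k) = (a i + b i) ^ (p ^ k)" for i k
    using disj[of i] prime_gt_0_nat[OF p] by (auto simp: power_0_left)
  thus "ghost p n (wadd p a b) = ghost p n (\<lambda>i. a i + b i)"
    by (simp add: ghost_wadd[OF p]) (simp add: ghost_def flip: sum.distrib distrib_left)
qed

lemma wadd_disjoint:
  fixes x y :: "nat \<Rightarrow> 'a::comm_ring_1"
  assumes p: "prime p" and disj: "\<And>i. x i = 0 \<or> y i = 0"
  shows "wadd p x y = (\<lambda>i. x i + y i)"
proof
  fix n
  \<comment> \<open>Generic vectors with zeros exactly where \<open>x\<close> and \<open>y\<close>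
    have them, so that the universal case applies before evaluation.\<close>
  define a b :: "nat \<Rightarrow> mpoly_int" where "a = (\<lambda>i. if x i = 0 then 0 else mvar (2 * i))"
    and "b = (\<lambda>i. if y i = 0 then 0 else mvar (2 * i + 1))"
  let ?ev = "meval (interleave x y)"
  have ev: "(\<lambda>i. ?ev (a i)) = x" "(\<lambda>i. ?ev (b i)) = y"
    by (auto simp: a_def b_def interleave_def)
  have "wadd p a b n = a n + b n"
    by (subst wadd_disjoint_mpoly[OF p]) (use disj in \<open>auto simp: a_def b_def\<close>)
  from arg_cong[OF this, of ?ev] show "wadd p x y n = x n + y n"
    by (simp add: meval_add meval_wadd ev fun_cong[OF ev(1)] fun_cong[OF ev(2)])
qed

lemma witt_add_disjoint:
  fixes x y :: "'a::comm_ring_prime_char witt"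
  assumes "\<And>i. witt_nth x i = 0 \<or> witt_nth y i = 0"
  shows "witt_nth (x + y) i = witt_nth x i + witt_nth y i"
proof -
  have "wadd CHAR('a) (witt_nth x) (witt_nth y) = (\<lambda>i. witt_nth x i + witt_nth y i)"
    by (rule wadd_disjoint[OF CHAR_prime]) (rule assms)
  thus ?thesis by (simp add: plus_witt_def)
qed

text \<open>Iterated Witt addition on bare sequences also makes sense over \<open>mpoly_int\<close>,
  where ghost components determine a vector; the type \<open>witt\<close> demands prime
  characteristic.\<close>

definition wsmult :: "nat \<Rightarrow> nat \<Rightarrow> (nat \<Rightarrow> 'a::comm_ring_1) \<Rightarrow> nat \<Rightarrow> 'a" where
  "wsmult p m x = ((\<lambda>y. wadd p x y) ^^ m) (\<lambda>_. 0)"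

lemma ghost_wsmult: "prime p \<Longrightarrow> ghost p n (wsmult p m x) = of_nat m * ghost p n x"
  by (induction m) (simp_all add: wsmult_def ghost_ops algebra_simps)

lemma meval_wsmult: "meval \<phi> (wsmult p m x n) = wsmult p m (\<lambda>i. meval \<phi> (x i)) n"
  by (induction m arbitrary: n) (simp_all add: wsmult_def meval_wadd)

lemma witt_nth_of_nat_mult:
  fixes x :: "'a::comm_ring_prime_char witt"
  shows "witt_nth (of_nat m * x) = wsmult CHAR('a) m (witt_nth x)"
proof (induction m)
  case 0
  show ?case by (simp add: wsmult_def fun_eq_iff)
next
  case (Suc m)
  have "of_nat (Suc m) * x = x + of_nat m * x" by (simp add: distrib_right)
  also have "witt_nth \<dots> = wsmult CHAR('a) (Suc m) (witt_nth x)"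
    by (simp add: plus_witt_def wsmult_def Suc)
  finally show ?case .
qed

text \<open>Multiplication by \<open>p\<close> is the composite of Verschiebung and Frobenius.\<close>

lemma witt_nth_CHAR_mult:
  fixes x :: "'a::comm_ring_prime_char witt"
  shows "witt_nth (of_nat CHAR('a) * x) n = (case n of 0 \<Rightarrow> 0 | Suc i \<Rightarrow> witt_nth x i ^ CHAR('a))"
proof -
  define p where "p = CHAR('a)"
  have p: "prime p" by (simp add: p_def)
  define y where "y = (\<lambda>n. case n of 0 \<Rightarrow> (0 :: mpoly_int) | Suc i \<Rightarrow> mvar i ^ p)"
  \<comment> \<open>The two ghost components differ by exactly \<open>p ^ Suc n * mvar n\<close>,
    the top term of \<open>p\<close> times \<open>ghost p n mvar\<close>.\<close>
  have "of_nat p ^ Suc n dvd ghost p n (wsmult p p mvar) - ghost p n y" for n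
  proof (cases n)
    case 0
    show ?thesis by (subst ghost_wsmult[OF p]) (simp add: 0 ghost_def y_def)
  next
    case (Suc m)
    have "ghost p (Suc m) y = (\<Sum>i\<le>m. of_nat p ^ Suc i * (mvar i ^ p) ^ (p ^ (m - i)))"
      unfolding ghost_def sum.atMost_Suc_shift using prime_gt_0_nat[OF p]
      by (simp add: y_def power_0_left)
    also have "\<dots> = of_nat p * (\<Sum>i<Suc m. of_nat p ^ i * mvar i ^ (p ^ (Suc m - i)))"
      unfolding sum_distrib_left lessThan_Suc_atMost
      by (intro sum.cong) (auto simp: Suc_diff_le simp flip: power_mult)
    finally have "ghost p n (wsmult p p mvar) - ghost p n y = of_nat p ^ Suc n * mvar n"
      unfolding ghost_wsmult[OF p] Suc by (subst ghost_Suc_split) (simp add: algebra_simps)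
    thus ?thesis by simp
  qed
  from ghost_cong_imp_cong[OF p this, of n]
  obtain c where c: "wsmult p p mvar n - y n = of_nat p * c" by (rule dvdE)
  have "(of_nat p :: 'a) = 0" by (simp add: p_def)
  with arg_cong[OF c, of "meval (witt_nth x)"] show ?thesis
    unfolding witt_nth_of_nat_mult
    by (simp add: meval_diff meval_mult meval_wsmult y_def p_def meval_power split: nat.splits)
qed

lemma witt_nth_CHAR_power_mult:
  fixes x :: "'a::comm_ring_prime_char witt"
  shows "witt_nth (of_nat CHAR('a) ^ m * x) n =
    (if n < m then 0 else witt_nth x (n - m) ^ (CHAR('a) ^ m))"
proof (induction m arbitrary: n)
  case (Suc m)
  have "of_nat CHAR('a) ^ Suc m * x = of_nat CHAR('a) * (of_nat CHAR('a) ^ m * x)"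
    by (simp add: mult_ac)
  thus ?case
    by (simp only: witt_nth_CHAR_mult Suc)
       (auto split: nat.splits simp: power_0_left mult.commute simp flip: power_mult)
qed auto

text \<open>Multiplication by \<open>p ^ m\<close> shifts by \<open>m\<close> places and raises
  entries to the power \<open>p ^ m\<close>. The converse extracts these roots in the algebraically
  closed field.\<close>

lemma CHAR_power_dvd_witt_iff:
  fixes x :: "'a::{alg_closed_field, field_prime_char} witt"
  shows "of_nat CHAR('a) ^ m dvd x \<longleftrightarrow> (\<forall>i<m. witt_nth x i = 0)"
proof
  assume *: "\<forall>i<m. witt_nth x i = 0"
  have "\<exists>y. \<forall>i. y i ^ (CHAR('a) ^ m) = witt_nth x (i + m)"
    by (intro choice allI) (metis nth_root_exists CHAR_pos zero_less_power)
  then obtain y where y: "\<And>i. y i ^ (CHAR('a) ^ m) = witt_nth x (i + m)" by blast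
  have "x = of_nat CHAR('a) ^ m * Witt y"
    by (rule witt_eqI) (use * in \<open>simp add: witt_nth_CHAR_power_mult y\<close>)
  thus "of_nat CHAR('a) ^ m dvd x" by simp
qed (auto simp: witt_nth_CHAR_power_mult elim!: dvdE)

lemma CHAR_dvd_witt_iff:
  fixes x :: "'a::{alg_closed_field, field_prime_char} witt"
  shows "of_nat CHAR('a) dvd x \<longleftrightarrow> witt_red x = 0"
  using CHAR_power_dvd_witt_iff[of 1 x] by (simp add: witt_red_def)

text \<open>Witt subtraction is not componentwise. Splitting a vector into its truncation
  \<open>T\<close> and its tail \<open>R\<close>, of disjoint supports, reduces the claim to
  divisibility of tails.\<close>

lemma witt_dvd_diff_iff:
  fixes x y :: "'a::{alg_closed_field, field_prime_char} witt"
  shows "of_nat CHAR('a) ^ m dvd x - y \<longleftrightarrow> (\<forall>i<m. witt_nth x i = witt_nth y i)"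
proof -
  define T where "T = (\<lambda>x :: 'a witt. Witt (\<lambda>i. if i < m then witt_nth x i else 0))"
  define R where "R = (\<lambda>x :: 'a witt. Witt (\<lambda>i. if i < m then 0 else witt_nth x i))"
  have split: "x = T x + R x" for x
    by (rule witt_eqI) (subst witt_add_disjoint; simp add: T_def R_def)
  have R: "of_nat CHAR('a) ^ m dvd R x" for x
    by (simp add: CHAR_power_dvd_witt_iff R_def)
  show ?thesis
  proof
    assume "of_nat CHAR('a) ^ m dvd x - y"
    hence "of_nat CHAR('a) ^ m dvd (x - y) + R y" using R by (intro dvd_add)
    hence d: "\<forall>i<m. witt_nth (x - y + R y) i = 0" by (simp add: CHAR_power_dvd_witt_iff)
    \<comment> \<open>The second summand starts at index \<open>m\<close>, where \<open>T y\<close>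
      ends, so this sum is componentwise.\<close>
    have x: "x = T y + (x - y + R y)" by (subst split[of y]) simp
    have "witt_nth x i = witt_nth (T y) i + witt_nth (x - y + R y) i" for i
      by (subst x, rule witt_add_disjoint) (use d in \<open>auto simp: T_def\<close>)
    thus "\<forall>i<m. witt_nth x i = witt_nth y i" using d by (simp add: T_def)
  next
    assume "\<forall>i<m. witt_nth x i = witt_nth y i"
    hence "T x = T y" by (auto simp: T_def)
    hence "x - y = R x - R y" using split[of x] split[of y] by (metis add_diff_cancel_left)
    thus "of_nat CHAR('a) ^ m dvd x - y" using R by simp
  qed
qed

text \<open>Component \<open>i\<close> no longer changes from \<open>xs i\<close> on, so the
  diagonal sequence is the limit.\<close>

lemma witt_complete:
  fixes xs :: "nat \<Rightarrow> 'a::{alg_closed_field, field_prime_char} witt"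
  assumes "\<And>m. of_nat CHAR('a) ^ Suc m dvd xs (Suc m) - xs m"
  obtains z where "\<And>m. of_nat CHAR('a) ^ Suc m dvd z - xs m"
proof
  fix m
  have step: "witt_nth (xs (Suc m)) i = witt_nth (xs m) i" if "i \<le> m" for m i
    using assms[of m] that unfolding witt_dvd_diff_iff by auto
  have eq: "witt_nth (xs m) i = witt_nth (xs i) i" if "i \<le> m" for m i
    using that by (induction m rule: dec_induct) (auto simp: step)
  show "of_nat CHAR('a) ^ Suc m dvd Witt (\<lambda>i. witt_nth (xs i) i) - xs m"
    unfolding witt_dvd_diff_iff witt.sel by (intro allI impI eq[symmetric]) simp
qed

section \<open>Hensel's lemma\<close>

lemma poly_diff_dvd:
  fixes P :: "'a::comm_ring_1 poly"
  shows "x - y dvd poly P x - poly P y"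
proof (induction P)
  case (pCons c P)
  thus ?case using dvd_diff_mult[of "x - y" x y "poly P x" "poly P y"] by simp
qed simp

lemma poly_taylor2_dvd:
  fixes P :: "'a::idom poly"
  shows "h ^ 2 dvd poly P (x + h) - (poly P x + h * poly (pderiv P) x)"
proof (induction P)
  case (pCons c P)
  then obtain d where d: "poly P (x + h) = poly P x + h * poly (pderiv P) x + h ^ 2 * d"
    by (metis dvdE diff_eq_eq add.commute)
  show ?case
    by (rule dvdI[of _ _ "(x + h) * d + poly (pderiv P) x"])
       (simp add: d pderiv_pCons, simp add: algebra_simps power2_eq_square)
qed simp

lemma witt_red_poly:
  fixes F :: "'a::idom_prime_char witt poly"
  shows "witt_red (poly F x) = poly (map_poly witt_red F) (witt_red x)"
proof (induction F)
  case (pCons c F)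
  thus ?case by (simp add: map_poly_pCons)
qed simp

lemma witt_red_diff [simp]: "witt_red (x - y) = witt_red x - witt_red (y :: 'a::comm_ring_prime_char witt)"
proof -
  have "witt_red x = witt_red (x - y) + witt_red y"
    unfolding witt_red_hom(3)[symmetric] by simp
  thus ?thesis by (simp only: add_diff_cancel_right')
qed

lemma witt_red_surj: "\<exists>w. witt_red w = a"
  by (rule exI[of _ "Witt (\<lambda>_. a)"]) (simp add: witt_red_def)

text \<open>Newton's iteration with a fixed approximate inverse \<open>b\<close> of the derivative.\<close>

lemma witt_hensel:
  fixes F :: "'a::{alg_closed_field, field_prime_char} witt poly"
  assumes root: "witt_red (poly F x0) = 0"
    and simple: "witt_red (poly (pderiv F) x0) \<noteq> 0"
  obtains x where "poly F x = 0" "witt_red x = witt_red x0"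
proof -
  let ?p = "of_nat CHAR('a) :: 'a witt"
  \<comment> \<open>Only the residue of the derivative is inverted; units of the Witt ring are
    obtained from this lemma afterwards.\<close>
  obtain b where b: "witt_red b = inverse (witt_red (poly (pderiv F) x0))"
    by (rule exE[OF witt_red_surj])
  define xs where "xs = (\<lambda>m. ((\<lambda>x. x - b * poly F x) ^^ m) x0)"
  have xs_Suc: "xs (Suc m) = xs m - b * poly F (xs m)" for m by (simp add: xs_def)
  have xs: "?p ^ Suc m dvd poly F (xs m) \<and> witt_red (xs m) = witt_red x0" for m
  proof (induction m)
    case 0
    show ?case using root by (simp add: xs_def CHAR_dvd_witt_iff)
  next
    case (Suc m)
    define y where "y = poly F (xs m)"
    have y: "?p ^ Suc m dvd y" and red: "witt_red (xs m) = witt_red x0" using Suc by (auto simp: y_def)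
    have "?p dvd y" using y by (rule dvd_trans[rotated]) simp
    hence red_y: "witt_red y = 0" by (simp add: CHAR_dvd_witt_iff)
    have "witt_red (poly (pderiv F) (xs m)) = witt_red (poly (pderiv F) x0)"
      using red by (simp add: witt_red_poly)
    \<comment> \<open>The linear part of the new value is \<open>y\<close> times this factor, so it
      gains one power of \<open>p\<close>.\<close>
    hence "?p dvd 1 - b * poly (pderiv F) (xs m)"
      using simple by (simp add: CHAR_dvd_witt_iff b)
    hence 1: "?p ^ Suc (Suc m) dvd y * (1 - b * poly (pderiv F) (xs m))"
      unfolding power_Suc2[of _ "Suc m"] using y by (intro mult_dvd_mono)
    \<comment> \<open>The quadratic error is divisible by the square of \<open>?p ^ Suc m\<close>,
      which suffices already for \<open>m = 0\<close>.\<close>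
    have "?p ^ Suc (Suc m) dvd ?p ^ (Suc m * 2)" by (intro le_imp_power_dvd) auto
    also have "?p ^ (Suc m * 2) dvd (- b * y) ^ 2"
      unfolding power_mult using y by (intro dvd_power_same dvd_mult)
    also have "\<dots> dvd poly F (xs (Suc m)) - (y + - b * y * poly (pderiv F) (xs m))"
      using poly_taylor2_dvd[of "- b * y" F "xs m"] by (simp add: y_def xs_Suc)
    finally have "?p ^ Suc (Suc m) dvd poly F (xs (Suc m)) - y * (1 - b * poly (pderiv F) (xs m))"
      by (simp add: algebra_simps)
    from dvd_add[OF this 1] show ?case
      using red red_y by (simp add: xs_Suc flip: y_def)
  qed
  have "?p ^ Suc m dvd xs (Suc m) - xs m" for m
    using xs[of m] by (simp add: xs_Suc)
  then obtain z where z: "\<And>m. ?p ^ Suc m dvd z - xs m" using witt_complete[of xs] by blast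
  \<comment> \<open>Divisibility by every power of \<open>p\<close> makes all components of the
    value vanish.\<close>
  have "?p ^ Suc m dvd poly F z" for m
    using dvd_add[OF dvd_trans[OF z[of m] poly_diff_dvd[of z "xs m" F]] conjunct1[OF xs[of m]]] by simp
  hence "poly F z = 0"
    by (intro witt_eqI) (auto simp: CHAR_power_dvd_witt_iff simp del: power_Suc)
  moreover have "witt_red z = witt_red x0"
    using z[of 0] xs[of 0] by (simp add: CHAR_dvd_witt_iff)
  ultimately show ?thesis by (rule that)
qed

lemma witt_red_power [simp]: "witt_red (x ^ n) = witt_red (x :: 'a::comm_ring_prime_char witt) ^ n"
  by (induction n) auto

lemma witt_red_of_nat [simp]: "witt_red (of_nat n) = (of_nat n :: 'a::comm_ring_prime_char)"
  by (induction n) auto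

text \<open>The inverse is the Hensel root of the linear polynomial with slope \<open>x\<close> and
  constant term -1.\<close>

lemma witt_unit:
  fixes x :: "'a::{alg_closed_field, field_prime_char} witt"
  assumes "witt_red x \<noteq> 0"
  obtains y where "x * y = 1"
proof -
  obtain y0 where y0: "witt_red y0 = inverse (witt_red x)" by (rule exE[OF witt_red_surj])
  have "witt_red (- 1) = (- 1 :: 'a)"
    using witt_red_diff[of 0 1] by simp
  hence "witt_red (poly [:-1, x:] y0) = 0"
    using assms by (simp add: y0)
  moreover have "witt_red (poly (pderiv [:-1, x:]) y0) \<noteq> 0"
    using assms by (simp add: pderiv_pCons)
  ultimately obtain y where "poly [:-1, x:] y = 0" by (rule witt_hensel)
  thus ?thesis by (intro that[of y]) (simp add: mult.commute)
qed

lemma witt_nth_root: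
  fixes w :: "'a::{alg_closed_field, field_prime_char} witt"
  assumes a: "a ^ n = witt_red w" and nz: "witt_red w \<noteq> 0" and n: "of_nat n \<noteq> (0 :: 'a)"
  obtains x where "x ^ n = w" "witt_red x = a"
proof -
  define F where "F = monom 1 n - [:w:]"
  obtain x0 where x0: "witt_red x0 = a" by (rule exE[OF witt_red_surj])
  have F: "poly F x = x ^ n - w" for x by (simp add: F_def poly_monom)
  have "witt_red (poly F x0) = 0"
    using a x0 by (simp add: F)
  \<comment> \<open>The derivative at \<open>x0\<close> reduces to \<open>n\<close> times a power of
    \<open>a\<close>, so both factors must be nonzero in the residue field.\<close>
  moreover have "a \<noteq> 0" using a nz n by (auto simp: power_0_left split: if_splits)
  hence "witt_red (poly (pderiv F) x0) \<noteq> 0"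
    using n x0 by (simp add: F_def pderiv_diff pderiv_monom pderiv_pCons poly_monom)
  ultimately obtain x where "poly F x = 0" "witt_red x = witt_red x0" by (rule witt_hensel)
  thus ?thesis by (intro that[of x]) (auto simp: F x0)
qed

section \<open>The lifted point\<close>

lemma witt_emb_hom [simp]:
  "witt_emb 0 = 0" "witt_emb 1 = 1" "witt_emb (x + y) = witt_emb x + witt_emb y"
  "witt_emb (x - y) = witt_emb x - witt_emb y" "witt_emb (x * y) = witt_emb x * witt_emb y"
  "witt_emb (of_nat n) = of_nat n"
proof -
  show 0: "witt_emb 0 = 0" and 1: "witt_emb 1 = 1"
    and add: "witt_emb (x + y) = witt_emb x + witt_emb y" for x y
    by (simp_all add: witt_emb_def)
  show "witt_emb (of_nat n) = of_nat n" by (induction n) (simp_all add: 0 1 add)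
qed (simp_all add: witt_emb_def)

lemma witt_emb_power [simp]: "witt_emb (x ^ n) = witt_emb x ^ n"
  by (induction n) simp_all

lemma witt_emb_eq_iff [simp]: "witt_emb x = witt_emb y \<longleftrightarrow> x = y"
  by (simp add: witt_emb_def)

lemma witt_adjoin_subset_range:
  assumes "S \<subseteq> range witt_emb"
  shows "witt_adjoin S = range witt_emb"
proof
  show "witt_adjoin S \<subseteq> range witt_emb"
    unfolding witt_adjoin_def subring_generated_def
    using assms by (intro Inter_lower) (auto simp flip: witt_emb_hom)
qed (auto simp: witt_adjoin_def subring_generated_def)

lemma reduction_mod_p_range:
  "reduction_mod_p (range witt_emb)
     (\<lambda>b :: 'a::{alg_closed_field, field_prime_char} witt fract alg_closure. witt_red (inv_into UNIV witt_emb b))"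
proof -
  have inv_emb [simp]: "inv_into UNIV witt_emb (witt_emb w) = w" for w :: "'a witt"
    by (rule inv_f_f) (auto simp: inj_def)
  have p_mult: "of_nat CHAR('a) * witt_emb w = witt_emb (of_nat CHAR('a) * w)" for w :: "'a witt"
    by simp
  have "{b \<in> range witt_emb. witt_red (inv_into UNIV witt_emb b) = 0} = witt_emb ` {w :: 'a witt. witt_red w = 0}"
    by auto
  also have "{w :: 'a witt. witt_red w = 0} = range (\<lambda>w. of_nat CHAR('a) * w)"
    by (auto simp flip: CHAR_dvd_witt_iff elim: dvdE)
  finally show ?thesis
    unfolding reduction_mod_p_def by (auto simp: image_image p_mult simp flip: witt_emb_hom(3,5) simp del: witt_emb_hom)
qed

lemma poly_legendre: "poly (legendre l) x = x * (x + 1) * (x + l)"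
  by (simp add: legendre_def algebra_simps)

lemma map_poly_witt_emb_legendre: "map_poly witt_emb (legendre l) = legendre (witt_emb l)"
  by (simp add: legendre_def map_poly_pCons)

text \<open>Both sides equal \<open>u ^ 2 * (u + 1) * (u ^ m + 1)\<close>, because
  \<open>u + t\<close> is \<open>u * (1 + u ^ m)\<close>. It serves for the given point and for its
  lift.\<close>

lemma legendre_point:
  fixes u t s :: "'a::field"
  assumes "u ^ Suc m = t" "s ^ 2 = (u ^ m + 1) / (u + 1)" "u + 1 \<noteq> 0"
  shows "(u * (u + 1) * s) ^ 2 = poly (legendre t) u"
proof -
  have "(u * (u + 1) * s) ^ 2 = u ^ 2 * (u + 1) ^ 2 * s ^ 2" by (simp add: power_mult_distrib)
  also have "\<dots> = u ^ 2 * (u + 1) * (u ^ m + 1)"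
    unfolding assms(2) using assms(3) by (simp add: power2_eq_square)
  finally show ?thesis
    by (simp add: poly_legendre assms(1)[symmetric] power2_eq_square algebra_simps)
qed

text \<open>Summing over all elements is invariant under translation by \<open>1\<close>.\<close>

lemma of_nat_card_UNIV_eq_0: "of_nat (card (UNIV :: 'a set)) = (0 :: 'a::{ring_1, finite})"
proof -
  have "(\<Sum>x\<in>UNIV. x) = (\<Sum>x\<in>UNIV. x + 1 :: 'a)"
    by (rule sum.reindex_bij_witness[of _ "\<lambda>x. x + 1" "\<lambda>x. x - 1"]) auto
  thus ?thesis by (simp add: sum.distrib)
qed

lemma is_algebraic_closure_embedding:
  fixes \<iota> :: "'a::field \<Rightarrow> 'b::alg_closed_field"
  assumes "is_algebraic_closure \<iota>"
  shows "\<iota> 0 = 0" "\<iota> 1 = 1" "\<iota> (of_nat n) = of_nat n" "inj \<iota>"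
proof -
  have 1: "\<iota> 1 = 1" and add: "\<iota> (a + b) = \<iota> a + \<iota> b" and mult: "\<iota> (a * b) = \<iota> a * \<iota> b" for a b
    using assms by (auto simp: is_algebraic_closure_def)
  show "\<iota> 1 = 1" by (fact 1)
  show 0: "\<iota> 0 = 0" using add[of 0 0] by (simp only: add_0 add_cancel_right_right)
  show "\<iota> (of_nat n) = of_nat n" by (induction n) (auto simp: 0 1 add)
  have nz: "\<iota> a \<noteq> 0" if "a \<noteq> 0" for a
    using mult[of a "inverse a"] 1 that by auto
  show "inj \<iota>"
  proof (rule injI)
    fix a b assume "\<iota> a = \<iota> b"
    hence "\<iota> (a - b) = 0" using add[of "a - b" b] by simp
    thus "a = b" using nz[of "a - b"] by auto
  qed
qed

theorem theorem3p3:
  fixes p q r f n :: nat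
    and \<iota> :: "'f::{field, finite} poly fract \<Rightarrow> 'k::{alg_closed_field, field_prime_char}"
    and t u :: 'k
    and lam :: "'k witt"
  assumes "prime p" and "\<not> p dvd 6"
    and "r \<ge> 1" and "q = p ^ r" and "card (UNIV :: 'f set) = q"
    and "is_algebraic_closure \<iota>" and "t = \<iota> (to_fract [:0, 1:])"
    and "canonical_legendre_coordinate t lam"
    and "f \<ge> 1" and "n = p ^ f + 1" and "u ^ n = t"
  shows "\<exists>U s \<rho>.
    let B = witt_adjoin {U, s};
        P = Aff u (u * (u + 1) ^ ((p ^ f + 1) div 2));
        P' = Aff U (U * (U + 1) * s)
    in U ^ n = witt_emb lam \<and>
       s ^ 2 = (U ^ (n - 1) + 1) / (U + 1) \<and>
       P \<in> ec_points (legendre t) \<and>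
       P' \<in> affine_points B (map_poly witt_emb (legendre lam)) \<and>
       reduction_mod_p B \<rho> \<and>
       map_ec_point \<rho> P' = P"
proof -
  note \<iota> = is_algebraic_closure_embedding[OF \<open>is_algebraic_closure \<iota>\<close>]
  \<comment> \<open>The order of the finite field is zero in it, hence in \<open>'k\<close>, so the
    prime characteristic of \<open>'k\<close> divides \<open>p ^ r\<close>.\<close>
  have "of_nat (p ^ r) = (0 :: 'f)"
    using of_nat_card_UNIV_eq_0[where 'a = 'f] assms by simp
  hence "of_nat (p ^ r) = (0 :: 'f poly fract)"
    by (metis of_nat_poly of_nat_fract to_fract_0 to_fract_def pCons_0_0)
  hence "of_nat (p ^ r) = (0 :: 'k)" using \<iota>(1,3) by metis
  hence CHAR: "CHAR('k) = p"
    using \<open>prime p\<close> by (simp add: primes_dvd_imp_eq prime_dvd_power_nat of_nat_eq_0_iff_char_dvd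
        flip: of_nat_power)
  have "to_fract [:0, 1 :: 'f:] \<noteq> 0" "to_fract [:0, 1 :: 'f:] \<noteq> 1"
    by (auto simp flip: to_fract_1 simp: one_pCons)
  hence t: "t \<noteq> 0" "t \<noteq> 1" using \<iota>(1,2) injD[OF \<iota>(4)] assms(7) by metis+
  have "p \<noteq> 2" using \<open>\<not> p dvd 6\<close> by auto
  hence "odd p" using \<open>prime p\<close> prime_odd_nat prime_ge_2_nat by (metis le_neq_implies_less)
  hence odd: "odd (p ^ f)" by simp
  \<comment> \<open>Here \<open>k\<close> is an exponent: \<open>(u + 1) ^ k\<close> will be the
    residue of the square root.\<close>
  define k where "k = (p ^ f - 1) div 2"
  have k: "p ^ f = Suc (2 * k)" using odd unfolding k_def by presburger
  have u1: "u + 1 \<noteq> 0"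
  proof
    assume "u + 1 = 0"
    hence "u = -1" by (simp add: add_eq_0_iff2)
    \<comment> \<open>The exponent \<open>n\<close> is even, so the \<open>n\<close>-th power of -1
      is 1.\<close>
    hence "t = 1" using assms odd by (auto simp flip: \<open>u ^ n = t\<close>)
    thus False using t by simp
  qed
  have red_lam: "witt_red lam = t" using assms by (simp add: canonical_legendre_coordinate_def)
  have of_nat_pf: "of_nat (p ^ f) = (0 :: 'k)"
    using \<open>f \<ge> 1\<close> CHAR by (simp add: of_nat_eq_0_iff_char_dvd)
  hence "of_nat n \<noteq> (0 :: 'k)" by (simp only: assms(10) of_nat_add of_nat_1 add_0 one_neq_zero not_False_eq_True)
  then obtain U where U: "U ^ n = lam" "witt_red U = u"
    using witt_nth_root[of u n lam] \<open>u ^ n = t\<close> red_lam t by metis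
  obtain V where V: "(U + 1) * V = 1"
    using witt_unit[of "U + 1"] u1 U(2) by auto
  \<comment> \<open>The quotient under the square root, formed inside the Witt ring through the
    inverse \<open>V\<close> of \<open>U + 1\<close>.\<close>
  define G where "G = (U ^ (p ^ f) + 1) * V"
  have G: "(U + 1) * G = U ^ (p ^ f) + 1"
    using V by (simp add: G_def mult_ac)
  have frob: "u ^ (p ^ f) + 1 = (u + 1) ^ (p ^ f)"
    using freshmans_dream'[of "p ^ f" f u 1] \<open>prime p\<close> CHAR by simp
  \<comment> \<open>Additivity of the power \<open>p ^ f\<close> turns the numerator into
    \<open>(u + 1) ^ Suc (2 * k)\<close>; cancelling \<open>u + 1\<close> leaves a square.\<close>
  have "(u + 1) * witt_red G = (u + 1) * ((u + 1) ^ k) ^ 2"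
    using arg_cong[OF G, of witt_red] U(2) frob k by (simp add: power_mult mult.commute[of 2])
  hence red_G: "((u + 1) ^ k) ^ 2 = witt_red G" using u1 by simp
  have "of_nat 2 \<noteq> (0 :: 'k)"
    using CHAR \<open>p \<noteq> 2\<close> \<open>prime p\<close> by (simp only: of_nat_eq_0_iff_char_dvd) (auto dest: primes_dvd_imp_eq[OF _ two_is_prime_nat])
  then obtain s where s: "s ^ 2 = G" "witt_red s = (u + 1) ^ k"
    using witt_nth_root[OF red_G] u1 red_G by (metis power_not_zero)
  define U' s' where "U' = witt_emb U" and "s' = witt_emb s"
  define \<rho> where "\<rho> = (\<lambda>b :: 'k witt fract alg_closure. witt_red (inv_into UNIV witt_emb b))"
  have U1: "U' + 1 \<noteq> 0"
  proof
    assume "U' + 1 = 0"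
    hence "witt_emb (U + 1) = witt_emb 0" by (simp add: U'_def)
    hence "U + 1 = 0" by (simp only: witt_emb_eq_iff)
    thus False using V by simp
  qed
  have B: "witt_adjoin {U', s'} = range witt_emb"
    by (rule witt_adjoin_subset_range) (auto simp: U'_def s'_def)
  have \<rho>: "\<rho> (witt_emb w) = witt_red w" for w
    unfolding \<rho>_def by (subst inv_f_f) (auto simp: inj_def)
  have Un: "U' ^ n = witt_emb lam" using U(1) by (simp add: U'_def flip: witt_emb_power)
  have s2: "s' ^ 2 = (U' ^ (n - 1) + 1) / (U' + 1)"
  proof -
    have "witt_emb ((U + 1) * s ^ 2) = witt_emb (U ^ (p ^ f) + 1)"
      by (simp only: s(1) G)
    hence "(U' + 1) * s' ^ 2 = U' ^ (n - 1) + 1"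
      by (simp add: U'_def s'_def assms(10))
    thus ?thesis using U1 by (simp add: field_simps)
  qed
  have y: "U' * (U' + 1) * s' = witt_emb (U * (U + 1) * s)" by (simp add: U'_def s'_def)
  \<comment> \<open>This writes the given \<open>y\<close>-coordinate as
    \<open>u * (u + 1) * (u + 1) ^ k\<close>, the shape to which the lifted one reduces.\<close>
  have exp: "(p ^ f + 1) div 2 = Suc k" using k by simp
  have "Aff u (u * (u + 1) * (u + 1) ^ k) \<in> ec_points (legendre t)"
  proof -
    have "((u + 1) ^ k) ^ 2 = (u ^ (n - 1) + 1) / (u + 1)"
      using frob u1 assms(10) k by (simp add: power_mult mult.commute[of 2])
    from legendre_point[OF _ this u1, of t] show ?thesis
      using assms(10,11) by (simp add: ec_points_def affine_points_def)
  qed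
  moreover have "Aff U' (U' * (U' + 1) * s') \<in> affine_points (range witt_emb) (map_poly witt_emb (legendre lam))"
  proof -
    have "U' \<in> range witt_emb" "U' * (U' + 1) * s' \<in> range witt_emb"
      by (simp only: U'_def rangeI) (simp only: y rangeI)
    thus ?thesis
      using legendre_point[OF _ s2 U1, of "witt_emb lam"] Un assms(10)
      by (simp add: map_poly_witt_emb_legendre affine_points_def)
  qed
  moreover have "map_ec_point \<rho> (Aff U' (U' * (U' + 1) * s')) = Aff u (u * (u + 1) * (u + 1) ^ k)"
    using U(2) s(2) by (simp only: ec_point.map y \<rho>) (simp add: U'_def \<rho>)
  moreover have "reduction_mod_p (range witt_emb) \<rho>"
    unfolding \<rho>_def by (rule reduction_mod_p_range)
  moreover have "u * (u + 1) ^ ((p ^ f + 1) div 2) = u * (u + 1) * (u + 1) ^ k"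
    by (simp only: exp power_Suc mult.assoc)
  ultimately have "let B = witt_adjoin {U', s'};
        P = Aff u (u * (u + 1) ^ ((p ^ f + 1) div 2));
        P' = Aff U' (U' * (U' + 1) * s')
    in U' ^ n = witt_emb lam \<and>
       s' ^ 2 = (U' ^ (n - 1) + 1) / (U' + 1) \<and>
       P \<in> ec_points (legendre t) \<and>
       P' \<in> affine_points B (map_poly witt_emb (legendre lam)) \<and>
       reduction_mod_p B \<rho> \<and>
       map_ec_point \<rho> P' = P"
    using Un s2 by (simp only: Let_def B simp_thms)
  thus ?thesis by (intro exI)
qed

end
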